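(* Let $(X,d)$ be a metric space with doubling constant $D$, let $P\subseteq X$ be a finite set of points, and let $r>0$. Let $G$ be the graph with vertex set $P$ in which two distinct points $p,q$ are adjacent iff $d(p,q)\le r/2$, let $G^2$ be the square of $G$ (same vertex set; $u\ne v$ adjacent iff they are adjacent in $G$ or have a common neighbor in $G$), and let $I$ be any maximal independent set of $G^2$. Then $I$ is a feasible solution of the dual clustering problem for $P$ with radius $r$ (every point of $P$ is within distance $r$ of some point of $I$), and $|I|\le D^2\cdot \mathrm{OPT}$, where $\mathrm{OPT}$ is the minimum size of a set $C\subseteq P$ such that every point of $P$ is within distance $r$ of some point of $C$. In other words, this algorithm is a $D^2$-approximation for dual clustering.
   Context: The doubling constant $D$ of $(X,d)$ is such that for every $x\in X$ and every $\rho\ge 0$, the closed ball of radius $2\rho$ centered at $x$ can be covered by at most $D$ closed balls of radius $\rho$ (centered at points of $X$). Dual clustering: given a point set $P$ and a radius $r$, find a smallest subset $C\subseteq P$ such that every point of $P$ is within distance $r$ of its closest point of $C$. *)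

theory Defs
  imports "HOL-Analysis.Abstract_Metric_Spaces" "Graph_Theory.Pair_Digraph"
begin

text \<open>
  A simple undirected graph is represented by a \<^locale>\<open>pair_graph\<close>: an edge between two
  vertices is the pair of opposite arcs.
\<close>

definition doubling :: "'a set \<Rightarrow> ('a \<Rightarrow> 'a \<Rightarrow> real) \<Rightarrow> nat \<Rightarrow> bool" where
  "doubling X d D \<longleftrightarrow>
     (\<forall>x\<in>X. \<forall>\<rho>\<ge>0. \<exists>S\<subseteq>X. finite S \<and> card S \<le> D \<and>
        Metric_space.mcball X d x (2 * \<rho>) \<subseteq> (\<Union>y\<in>S. Metric_space.mcball X d y \<rho>))"

definition proximity_graph :: "('a \<Rightarrow> 'a \<Rightarrow> real) \<Rightarrow> 'a set \<Rightarrow> real \<Rightarrow> 'a pair_pre_digraph" where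
  "proximity_graph d P t =
     \<lparr> pverts = P, parcs = {(p, q). p \<in> P \<and> q \<in> P \<and> p \<noteq> q \<and> d p q \<le> t} \<rparr>"

definition graph_square :: "'a pair_pre_digraph \<Rightarrow> 'a pair_pre_digraph" where
  "graph_square G =
     \<lparr> pverts = pverts G,
       parcs = {(u, v). u \<in> pverts G \<and> v \<in> pverts G \<and> u \<noteq> v \<and>
                  ((u, v) \<in> parcs G \<or>
                   (\<exists>w\<in>pverts G. (u, w) \<in> parcs G \<and> (v, w) \<in> parcs G))} \<rparr>"

definition independent_set :: "'a pair_pre_digraph \<Rightarrow> 'a set \<Rightarrow> bool" where
  "independent_set G I \<longleftrightarrow>
     I \<subseteq> pverts G \<and> (\<forall>u\<in>I. \<forall>v\<in>I. u \<noteq> v \<longrightarrow> (u, v) \<notin> parcs G)"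

text \<open>Maximal with respect to inclusion, not of maximum cardinality.\<close>

definition maximal_independent_set :: "'a pair_pre_digraph \<Rightarrow> 'a set \<Rightarrow> bool" where
  "maximal_independent_set G I \<longleftrightarrow>
     independent_set G I \<and> (\<forall>J. independent_set G J \<longrightarrow> I \<subseteq> J \<longrightarrow> J = I)"

definition dual_clustering_feasible ::
    "('a \<Rightarrow> 'a \<Rightarrow> real) \<Rightarrow> 'a set \<Rightarrow> real \<Rightarrow> 'a set \<Rightarrow> bool" where
  "dual_clustering_feasible d P r C \<longleftrightarrow> C \<subseteq> P \<and> (\<forall>p\<in>P. \<exists>c\<in>C. d p c \<le> r)"

text \<open>
  For finite \<open>P\<close> in a metric space and \<open>r \<ge> 0\<close> the set \<open>P\<close> itself is feasible and all
  feasible sets are finite, so the minimum below is attained and is a genuine cardinality.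
\<close>

definition dual_clustering_opt :: "('a \<Rightarrow> 'a \<Rightarrow> real) \<Rightarrow> 'a set \<Rightarrow> real \<Rightarrow> nat" where
  "dual_clustering_opt d P r = (LEAST k. \<exists>C. dual_clustering_feasible d P r C \<and> card C = k)"

lemma pair_graph_proximity_graph:
  assumes "Metric_space X d" and "finite P"
  shows "pair_graph (proximity_graph d P t)"
proof
  have "{(p, q). p \<in> P \<and> q \<in> P \<and> p \<noteq> q \<and> d p q \<le> t} \<subseteq> P \<times> P" by auto
  then show "finite (parcs (proximity_graph d P t))"
    using assms(2) by (auto simp: proximity_graph_def intro: finite_subset)
  show "symmetric (with_proj (proximity_graph d P t))"
    using Metric_space.commute[OF assms(1)]
    by (auto simp: symmetric_def proximity_graph_def sym_def)
qed (use assms in \<open>auto simp: proximity_graph_def\<close>)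

lemma pair_graph_graph_square:
  assumes "pair_graph G"
  shows "pair_graph (graph_square G)"
proof -
  interpret pair_graph G by (fact assms)
  have "parcs (graph_square G) \<subseteq> pverts G \<times> pverts G" by (auto simp: graph_square_def)
  then have fin: "finite (parcs (graph_square G))"
    using pair_finite_verts by (auto intro: finite_subset)
  have "sym (parcs G)" using pair_sym_arcs by (simp add: symmetric_def)
  then have "sym (parcs (graph_square G))" by (auto simp: graph_square_def sym_def)
  then show ?thesis
    using fin pair_finite_verts
    by unfold_locales (auto simp: graph_square_def symmetric_def)
qed

end

theory Submission
  imports Defs
begin

text \<open>
  Vertices adjacent in \<open>G\<^sup>2\<close> are at distance at most \<open>r\<close>, so maximality makes \<open>I\<close> feasible. The
  \<open>r\<close>-balls around the centres of an optimal solution cover \<open>P\<close>, and halving the radius twice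
  replaces each of them by \<open>D\<^sup>2\<close> balls of radius \<open>r/4\<close>. Two distinct points of \<open>P\<close> in one small
  ball are adjacent already in \<open>G\<close>, so each small ball contains at most one point of \<open>I\<close>.
\<close>

text \<open>Induction on \<open>n\<close>: the hypothesis at radius \<open>2 * \<rho>\<close> gives
  at most \<open>D ^ n\<close> balls, and doubling splits each of them into at most \<open>D\<close>
  balls of radius \<open>\<rho>\<close>. This is why \<open>\<rho>\<close> is generalized.\<close>

lemma doubling_iterate:
  assumes dbl: "doubling X d D" and "x \<in> X" "\<rho> \<ge> 0"
  shows "\<exists>S\<subseteq>X. finite S \<and> card S \<le> D ^ n \<and>
           Metric_space.mcball X d x (2 ^ n * \<rho>) \<subseteq> (\<Union>y\<in>S. Metric_space.mcball X d y \<rho>)"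
  using \<open>\<rho> \<ge> 0\<close>
proof (induction n arbitrary: \<rho>)
  case 0
  \<comment> \<open>Here \<open>2 ^ 0 * \<rho>\<close> is \<open>\<rho>\<close>, so the ball covers
    itself.\<close>
  show ?case using \<open>x \<in> X\<close> by (intro exI[of _ "{x}"]) simp
next
  case (Suc n)
  obtain S where S: "S \<subseteq> X" "finite S" "card S \<le> D ^ n"
    "Metric_space.mcball X d x (2 ^ n * (2 * \<rho>)) \<subseteq> (\<Union>y\<in>S. Metric_space.mcball X d y (2 * \<rho>))"
    using Suc.IH[of "2 * \<rho>"] Suc.prems by auto
  have "\<forall>y\<in>S. \<exists>T\<subseteq>X. finite T \<and> card T \<le> D \<and>
      Metric_space.mcball X d y (2 * \<rho>) \<subseteq> (\<Union>z\<in>T. Metric_space.mcball X d z \<rho>)"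
    using dbl S(1) Suc.prems unfolding doubling_def by blast
  then obtain T where T: "\<And>y. y \<in> S \<Longrightarrow> T y \<subseteq> X" "\<And>y. y \<in> S \<Longrightarrow> finite (T y)"
    "\<And>y. y \<in> S \<Longrightarrow> card (T y) \<le> D"
    "\<And>y. y \<in> S \<Longrightarrow>
       Metric_space.mcball X d y (2 * \<rho>) \<subseteq> (\<Union>z\<in>T y. Metric_space.mcball X d z \<rho>)"
    by metis
  have "card (\<Union>(T ` S)) \<le> (\<Sum>y\<in>S. card (T y))"
    using S(2) by (rule card_UN_le)
  also have "\<dots> \<le> card S * D" using sum_bounded_above[of S "\<lambda>y. card (T y)" D] T(3) by simp
  also have "\<dots> \<le> D ^ Suc n" using S(3) by simp
  finally have "card (\<Union>(T ` S)) \<le> D ^ Suc n" .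
  moreover have "Metric_space.mcball X d x (2 ^ Suc n * \<rho>)
      \<subseteq> (\<Union>z\<in>\<Union>(T ` S). Metric_space.mcball X d z \<rho>)"
  proof -
    have "2 ^ Suc n * \<rho> = 2 ^ n * (2 * \<rho>)" by simp
    then have "Metric_space.mcball X d x (2 ^ Suc n * \<rho>)
        \<subseteq> (\<Union>y\<in>S. Metric_space.mcball X d y (2 * \<rho>))"
      using S(4) by (simp only:)
    also have "\<dots> \<subseteq> (\<Union>y\<in>S. \<Union>z\<in>T y. Metric_space.mcball X d z \<rho>)"
      using T(4) by (rule UN_mono[OF order_refl])
    finally show ?thesis by (simp only: UN_UN_flatten)
  qed
  ultimately show ?case using S(2) T(1,2) by (intro exI[of _ "\<Union>(T ` S)"]) auto
qed

text \<open>Pigeonhole: two points of one ball of radius \<open>\<rho>\<close> are at distance at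
  most \<open>2 * \<rho>\<close>, so sending each point of \<open>A\<close> to the centre of a small
  ball that contains it is injective.\<close>

lemma (in Metric_space) card_separated_in_mcball_le:
  assumes dbl: "doubling M d D" and "x \<in> M" "\<rho> \<ge> 0"
    and A: "A \<subseteq> mcball x (2 ^ n * \<rho>)"
    and sep: "\<And>p q. p \<in> A \<Longrightarrow> q \<in> A \<Longrightarrow> p \<noteq> q \<Longrightarrow> d p q > 2 * \<rho>"
  shows "card A \<le> D ^ n"
proof -
  obtain S where S: "finite S" "card S \<le> D ^ n" "mcball x (2 ^ n * \<rho>) \<subseteq> (\<Union>y\<in>S. mcball y \<rho>)"
    using doubling_iterate[OF assms(1-3), of n] by blast
  with A have "\<forall>p\<in>A. \<exists>y. y \<in> S \<and> p \<in> mcball y \<rho>" by blast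
  then obtain f where f: "\<And>p. p \<in> A \<Longrightarrow> f p \<in> S \<and> p \<in> mcball (f p) \<rho>"
    unfolding bchoice_iff by blast
  have "inj_on f A"
  proof (rule inj_onI, rule ccontr)
    fix p q assume pq: "p \<in> A" "q \<in> A" "f p = f q" "p \<noteq> q"
    then have "p \<in> mcball (f p) \<rho>" "q \<in> mcball (f p) \<rho>" using f by metis+
    then have "d p q \<le> 2 * \<rho>"
      using triangle''[of p "f p" q] by (simp add: in_mcball)
    with sep[OF pq(1,2,4)] show False by simp
  qed
  then have "card A \<le> card S" using f S(1) by (intro card_inj_on_le[of f]) auto
  with S(2) show ?thesis by simp
qed

text \<open>A common neighbour costs two steps of length at most \<open>t\<close>; for a direct
  edge, \<open>t \<ge> 0\<close> gives \<open>t \<le> 2 * t\<close>.\<close>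

lemma (in Metric_space) graph_square_proximity_dist_le:
  assumes "P \<subseteq> M" and "t \<ge> 0" and "(u, v) \<in> parcs (graph_square (proximity_graph d P t))"
  shows "d u v \<le> 2 * t"
proof -
  have uv: "u \<in> M" "v \<in> M" using assms by (auto simp: graph_square_def proximity_graph_def)
  consider "d u v \<le> t" | w where "w \<in> M" "d u w \<le> t" "d v w \<le> t"
    using assms by (auto simp: graph_square_def proximity_graph_def)
  then show ?thesis
  proof cases
    case 1
    with assms(2) show ?thesis by simp
  next
    case (2 w)
    with uv triangle'[of u w v] show ?thesis by simp
  qed
qed

text \<open>Otherwise \<open>insert p I\<close> would be a larger independent set. Symmetry of the
  arcs is needed because independence excludes both orientations.\<close>

lemma maximal_independent_set_dominating:
  assumes G: "pair_graph G" and max: "maximal_independent_set G I"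
    and p: "p \<in> pverts G" "p \<notin> I"
  shows "\<exists>u\<in>I. (p, u) \<in> parcs G"
proof (rule ccontr)
  assume non: "\<not> ?thesis"
  interpret pair_graph G by (fact G)
  have sym: "(u, v) \<in> parcs G \<longleftrightarrow> (v, u) \<in> parcs G" for u v
    using pair_sym_arcs by (auto simp: symmetric_def sym_def)
  have "independent_set G I" using max by (simp add: maximal_independent_set_def)
  with non p(1) sym have "independent_set G (insert p I)" by (simp add: independent_set_def)
  then have "insert p I = I" using max by (auto simp: maximal_independent_set_def)
  with p show False by blast
qed

text \<open>The feasible \<open>C\<close> ensures that \<open>LEAST\<close> ranges over a nonempty
  set of cardinalities, so its value is one of them.\<close>

lemma dual_clustering_opt_attained:
  assumes "dual_clustering_feasible d P r C"
  obtains C' where "dual_clustering_feasible d P r C'" "card C' = dual_clustering_opt d P r"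
  using LeastI[of "\<lambda>k. \<exists>C. dual_clustering_feasible d P r C \<and> card C = k" "card C"] assms
  unfolding dual_clustering_opt_def by blast

theorem theorem1:
  fixes X :: "'a set" and d :: "'a \<Rightarrow> 'a \<Rightarrow> real" and D :: nat
    and P I :: "'a set" and r :: real
  assumes "Metric_space X d"
    and "doubling X d D"
    and "P \<subseteq> X" and "finite P"
    and "r > 0"
    and "maximal_independent_set (graph_square (proximity_graph d P (r / 2))) I"
  shows "dual_clustering_feasible d P r I \<and>
         card I \<le> D\<^sup>2 * dual_clustering_opt d P r"
proof
  interpret Metric_space X d by (fact assms(1))
  let ?H = "graph_square (proximity_graph d P (r / 2))"
  have verts: "pverts ?H = P" by (simp add: graph_square_def proximity_graph_def)
  have IP: "I \<subseteq> P"
    using assms(6) verts by (simp add: maximal_independent_set_def independent_set_def)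
  have H: "pair_graph ?H"
    using assms(1,4) by (intro pair_graph_graph_square pair_graph_proximity_graph)
  have "\<exists>c\<in>I. d p c \<le> r" if p: "p \<in> P" for p
  proof (cases "p \<in> I")
    case True
    then show ?thesis using p assms(3,5) by (intro bexI[of _ p]) auto
  next
    case False
    with p verts obtain u where "u \<in> I" "(p, u) \<in> parcs ?H"
      using maximal_independent_set_dominating[OF H assms(6)] by auto
    then show ?thesis
      using graph_square_proximity_dist_le[OF assms(3), of "r / 2" p u] assms(5) by auto
  qed
  with IP show feas: "dual_clustering_feasible d P r I"
    by (simp add: dual_clustering_feasible_def)

  \<comment> \<open>The radius \<open>r / 4\<close> fits both ends: doubled it is the threshold
    \<open>r / 2\<close> of the proximity graph, and doubled twice it is the clustering radius
    \<open>r\<close>. Only the direct edges of the square are used here.\<close>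
  have sep: "d p q > 2 * (r / 4)" if "p \<in> I" "q \<in> I" "p \<noteq> q" for p q
  proof -
    have "(p, q) \<notin> parcs ?H"
      using assms(6) that by (simp add: maximal_independent_set_def independent_set_def)
    then have "\<not> d p q \<le> r / 2"
      using that IP by (auto simp: graph_square_def proximity_graph_def)
    then show ?thesis by simp
  qed
  obtain C where C: "dual_clustering_feasible d P r C" "card C = dual_clustering_opt d P r"
    using dual_clustering_opt_attained[OF feas] by blast
  have CP: "C \<subseteq> P" and cov: "\<And>p. p \<in> P \<Longrightarrow> \<exists>c\<in>C. d p c \<le> r"
    using C(1) by (auto simp: dual_clustering_feasible_def)
  have fin: "finite C" "finite I" using CP IP assms(4) finite_subset by auto
  have "I \<subseteq> (\<Union>c\<in>C. I \<inter> mcball c r)"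
  proof
    fix p assume "p \<in> I"
    with IP cov obtain c where "c \<in> C" "d p c \<le> r" by blast
    with \<open>p \<in> I\<close> IP CP assms(3) show "p \<in> (\<Union>c\<in>C. I \<inter> mcball c r)"
      by (intro UN_I[of c]) (auto simp: in_mcball commute)
  qed
  then have "card I \<le> card (\<Union>c\<in>C. I \<inter> mcball c r)"
    using fin by (intro card_mono) auto
  also have "\<dots> \<le> (\<Sum>c\<in>C. card (I \<inter> mcball c r))"
    using fin(1) by (rule card_UN_le)
  also have "\<dots> \<le> (\<Sum>c\<in>C. D\<^sup>2)"
  proof (rule sum_mono)
    fix c assume "c \<in> C"
    with CP assms(3) have "c \<in> X" by blast
    \<comment> \<open>The exponent \<open>n\<close> is fixed to 2 by unification with
      \<open>D\<^sup>2\<close>, and \<open>2 ^ 2 * (r / 4)\<close> simplifies to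
      \<open>r\<close>.\<close>
    then show "card (I \<inter> mcball c r) \<le> D\<^sup>2"
      using assms(5) sep
      by (intro card_separated_in_mcball_le[OF assms(2), of c "r / 4"]) auto
  qed
  finally show "card I \<le> D\<^sup>2 * dual_clustering_opt d P r"
    using C(2) by (simp add: mult.commute)
qed

end
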